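(* The geodesics of the Finsler-Poincaré disc $(\mathbb{D},F_P)$ are the diametric line segments and the circular arcs that intersect the boundary circle $\partial\mathbb{D}$ orthogonally (in the Euclidean sense). More explicitly, under the isometry $f:(\mathbb{D},F_F)\to(\mathbb{D},F_P)$: (i) the line segments in the Funk disc passing through the centre of the disc correspond to the diametric line segments in the Finsler-Poincaré disc passing through the centre of the disc; (ii) the other line segments in the Funk disc correspond to the circular arcs that intersect the boundary circle orthogonally.
   Context: $|\cdot|$ and $\langle\cdot,\cdot\rangle$ are the Euclidean norm and inner product. Geodesics are regarded as point sets (trajectories of complete-as-possible geodesics). $\mathbb{D}=\{x\in\mathbb{R}^2:|x|<1\}$. The Funk metric is $F_F(x,v)=\dfrac{\sqrt{(1-|x|^2)|v|^2+\langle x,v\rangle^2}}{1-|x|^2}+\dfrac{\langle x,v\rangle}{1-|x|^2}$; its geodesics, as point sets, are the straight line segments in $\mathbb{D}$, and "line segments in the Funk disc" means maximal ones, i.e. open chords $\ell\cap\mathbb{D}$ with $\ell$ a line meeting $\mathbb{D}$. The Finsler-Poincaré metric is $F_P(x,v)=\dfrac{2|v|}{1-|x|^2}+\dfrac{4\langle x,v\rangle}{1-|x|^4}$. The map $f:\mathbb{D}\to\mathbb{D}$, $f(x)=\dfrac{x}{1+\sqrt{1-|x|^2}}$, is a (known) isometry from $(\mathbb{D},F_F)$ to $(\mathbb{D},F_P)$, i.e. a diffeomorphism with $F_P(f(x),Df_x(v))=F_F(x,v)$. "Correspond" means: are mapped by $f$ to. *)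

theory Defs
  imports "HOL-Analysis.Analysis"
begin

abbreviation disc :: "(real^2) set" where
  "disc \<equiv> ball 0 1"

definition funk_metric :: "real^2 \<Rightarrow> real^2 \<Rightarrow> real" where
  "funk_metric x v =
     sqrt ((1 - (norm x)\<^sup>2) * (norm v)\<^sup>2 + (x \<bullet> v)\<^sup>2) / (1 - (norm x)\<^sup>2)
     + (x \<bullet> v) / (1 - (norm x)\<^sup>2)"

definition poincare_metric :: "real^2 \<Rightarrow> real^2 \<Rightarrow> real" where
  "poincare_metric x v =
     2 * norm v / (1 - (norm x)\<^sup>2) + 4 * (x \<bullet> v) / (1 - norm x ^ 4)"

definition funk_poincare :: "real^2 \<Rightarrow> real^2" where
  "funk_poincare x = (1 / (1 + sqrt (1 - (norm x)\<^sup>2))) *\<^sub>R x"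


definition has_finsler_length ::
  "(real^2 \<Rightarrow> real^2 \<Rightarrow> real) \<Rightarrow> (real \<Rightarrow> real^2) \<Rightarrow> real \<Rightarrow> real \<Rightarrow> real \<Rightarrow> bool" where
  "has_finsler_length F c a b L \<longleftrightarrow>
     ((\<lambda>t. F (c t) (vector_derivative c (at t))) has_integral L) {a..b}"

(* The speed of a valid_path may be unbounded near its finitely many exceptional
   parameters, so its length may be infinite.  Stating the length through has_integral
   leaves such paths out of the infimum; with the total function "integral" they would
   enter it with the value 0. *)
definition finsler_dist ::
  "(real^2 \<Rightarrow> real^2 \<Rightarrow> real) \<Rightarrow> (real^2) set \<Rightarrow> real^2 \<Rightarrow> real^2 \<Rightarrow> real" where
  "finsler_dist F M p q =
     Inf {L. \<exists>g. valid_path g \<and> path_image g \<subseteq> M \<and> pathstart g = p \<and> pathfinish g = q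
               \<and> has_finsler_length F g 0 1 L}"

(* Geodesics are nonconstant curves of constant speed that locally minimise length.
   F need not be reversible, so minimality concerns the forward direction only. *)
definition finsler_geodesic ::
  "(real^2 \<Rightarrow> real^2 \<Rightarrow> real) \<Rightarrow> (real^2) set \<Rightarrow> real set \<Rightarrow> (real \<Rightarrow> real^2) \<Rightarrow> bool" where
  "finsler_geodesic F M I c \<longleftrightarrow>
     open I \<and> is_interval I \<and> I \<noteq> {} \<and> c C1_differentiable_on I \<and> c ` I \<subseteq> M
     \<and> (\<exists>k>0. \<forall>t\<in>I. F (c t) (vector_derivative c (at t)) = k)
     \<and> (\<forall>t\<in>I. \<exists>\<delta>>0. \<forall>a\<in>I \<inter> ball t \<delta>. \<forall>b\<in>I \<inter> ball t \<delta>. a \<le> b \<longrightarrow>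
           has_finsler_length F c a b (finsler_dist F M (c a) (c b)))"

definition maximal_geodesic ::
  "(real^2 \<Rightarrow> real^2 \<Rightarrow> real) \<Rightarrow> (real^2) set \<Rightarrow> real set \<Rightarrow> (real \<Rightarrow> real^2) \<Rightarrow> bool" where
  "maximal_geodesic F M I c \<longleftrightarrow>
     finsler_geodesic F M I c
     \<and> (\<forall>J d. finsler_geodesic F M J d \<and> I \<subseteq> J \<and> (\<forall>t\<in>I. d t = c t) \<longrightarrow> J = I)"

definition geodesic_trajectories ::
  "(real^2 \<Rightarrow> real^2 \<Rightarrow> real) \<Rightarrow> (real^2) set \<Rightarrow> (real^2) set set" where
  "geodesic_trajectories F M = {c ` I | I c. maximal_geodesic F M I c}"


definition chords :: "(real^2) set set" where
  "chords = {l \<inter> disc | l. affine l \<and> aff_dim l = 1 \<and> l \<inter> disc \<noteq> {}}"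

definition diametric_segments :: "(real^2) set set" where
  "diametric_segments = {open_segment (- u) u | u. norm u = 1}"

definition circle_tangent :: "real^2 \<Rightarrow> real^2 \<Rightarrow> (real^2) set" where
  "circle_tangent z p = {v. (p - z) \<bullet> v = 0}"

definition orthogonal_circles :: "real^2 \<Rightarrow> real \<Rightarrow> real^2 \<Rightarrow> real \<Rightarrow> bool" where
  "orthogonal_circles z r w s \<longleftrightarrow>
     sphere z r \<inter> sphere w s \<noteq> {}
     \<and> (\<forall>p \<in> sphere z r \<inter> sphere w s.
          \<forall>v \<in> circle_tangent z p. \<forall>v' \<in> circle_tangent w p. orthogonal v v')"

definition orthogonal_arcs :: "(real^2) set set" where
  "orthogonal_arcs = {sphere z r \<inter> disc | z r. r > 0 \<and> orthogonal_circles z r 0 1}"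


lemma funk_poincare_isometry:
  assumes x: "x \<in> disc"
  shows "\<exists>D. (funk_poincare has_derivative D) (at x)
           \<and> (\<forall>v. poincare_metric (funk_poincare x) (D v) = funk_metric x v)"
proof -
  define s where "s = sqrt (1 - (norm x)\<^sup>2)"
  have n1: "(norm x)\<^sup>2 < 1" using x by (simp add: power_less_one_iff abs_square_less_1)
  have s: "s > 0" and s2: "s\<^sup>2 = 1 - (norm x)\<^sup>2" using n1 by (auto simp: s_def)
  define D where "D = (\<lambda>v. (1 / (1 + s)) *\<^sub>R v + ((x \<bullet> v) / (s * (1 + s)\<^sup>2)) *\<^sub>R x)"
  have eq: "funk_poincare = (\<lambda>y. (1 / (1 + sqrt (1 - y \<bullet> y))) *\<^sub>R y)"
    by (auto simp: funk_poincare_def dot_square_norm)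
  have s': "sqrt (1 - x \<bullet> x) = s" by (simp add: s_def dot_square_norm)
  have pos: "1 - x \<bullet> x > 0" using n1 by (simp add: dot_square_norm)
  have "(funk_poincare has_derivative D) (at x)"
    unfolding eq
    apply (rule derivative_eq_intros refl | (use pos s s' in simp; fail))+
    using s by (auto simp: s' D_def inner_commute divide_simps power2_eq_square fun_eq_iff)
  moreover have "poincare_metric (funk_poincare x) (D v) = funk_metric x v" for v
  proof -
    define w where "w = x \<bullet> v"
    have fx: "funk_poincare x = (1 / (1 + s)) *\<^sub>R x" by (simp add: funk_poincare_def s_def)
    have xx: "x \<bullet> x = 1 - s\<^sup>2" using s2 by (simp add: dot_square_norm)
    have nf: "(norm (funk_poincare x))\<^sup>2 = (1 - s) / (1 + s)"
    proof -
      have "(norm (funk_poincare x))\<^sup>2 = (1 - s\<^sup>2) / (1 + s)\<^sup>2"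
        using s2 s by (simp add: fx power_divide)
      also have "1 - s\<^sup>2 = (1 - s) * (1 + s)" by (simp add: power2_eq_square algebra_simps)
      finally show ?thesis using s by (simp add: power2_eq_square)
    qed
    have n4: "norm (funk_poincare x) ^ 4 = ((1 - s) / (1 + s))\<^sup>2"
      unfolding nf[symmetric] by simp
    have d1: "1 - (norm (funk_poincare x))\<^sup>2 = 2 * s / (1 + s)"
      unfolding nf using s by (simp add: field_simps)
    have d2: "1 - norm (funk_poincare x) ^ 4 = 4 * s / (1 + s)\<^sup>2"
    proof -
      have "1 - ((1 - s) / (1 + s))\<^sup>2 = ((1 + s)\<^sup>2 - (1 - s)\<^sup>2) / (1 + s)\<^sup>2"
        unfolding power_divide using s by (simp add: diff_divide_distrib[of "(1 + s)\<^sup>2"])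
      also have "(1 + s)\<^sup>2 - (1 - s)\<^sup>2 = 4 * s" by (simp add: power2_eq_square algebra_simps)
      finally show ?thesis by (simp add: n4)
    qed
    define e i where "e = 1 / (1 + s)" and "i = 1 / s"
    have ei: "e * (1 + s) = 1" "i * s = 1" using s by (auto simp: e_def i_def)
    have Dv: "D v = e *\<^sub>R v + (w * i * e\<^sup>2) *\<^sub>R x"
      by (simp add: D_def e_def i_def w_def power_divide)
    have "funk_poincare x \<bullet> D v = e * (e * w + w * i * e\<^sup>2 * (1 - s\<^sup>2))"
      by (simp add: fx Dv e_def[symmetric] inner_add_right xx w_def[symmetric] distrib_left)
    also have "\<dots> = w * i * e\<^sup>2" using ei by algebra
    finally have in1: "funk_poincare x \<bullet> D v = w / (s * (1 + s)\<^sup>2)"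
      by (simp add: e_def i_def power_divide)
    have "(norm (D v))\<^sup>2 = D v \<bullet> D v" by (simp add: dot_square_norm)
    also have "\<dots> = e\<^sup>2 * (v \<bullet> v) + 2 * (e * (w * i * e\<^sup>2) * w) + (w * i * e\<^sup>2)\<^sup>2 * (1 - s\<^sup>2)"
      by (simp add: Dv inner_add_right inner_add_left xx w_def[symmetric]
          inner_commute[of v x] algebra_simps power2_eq_square)
    also have "\<dots> = (s\<^sup>2 * (v \<bullet> v) + w\<^sup>2) * (i * e)\<^sup>2" using ei by algebra
    finally have "(norm (D v))\<^sup>2 = (s\<^sup>2 * (v \<bullet> v) + w\<^sup>2) / (s * (1 + s))\<^sup>2"
      by (simp add: e_def i_def power_divide)
    then have "norm (D v) = sqrt ((s\<^sup>2 * (v \<bullet> v) + w\<^sup>2) / (s * (1 + s))\<^sup>2)"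
      by (metis norm_ge_zero real_sqrt_abs abs_of_nonneg)
    then have nD: "norm (D v) = sqrt (s\<^sup>2 * (v \<bullet> v) + w\<^sup>2) / (s * (1 + s))"
      using s by (simp add: real_sqrt_divide)
    have c: "2 * (A / (s * q)) / (2 * s / q) = A / s\<^sup>2"
            "4 * (B / (s * q\<^sup>2)) / (4 * s / q\<^sup>2) = B / s\<^sup>2" if "q > 0" for A B q :: real
      using s that by (auto simp: power2_eq_square)
    show ?thesis
      unfolding poincare_metric_def funk_metric_def d1 d2 in1 nD s2[symmetric]
      using s by (simp only: c add_pos_pos zero_less_one w_def dot_square_norm)
  qed
  ultimately show ?thesis by blast
qed

end

(* The map g(y) = 2 y / (1 + |y|^2) inverts f, so lengths of curves may be computed in the Funk
   disc.  There the value F of the metric at (x, v) satisfies |F x + v| = F, hence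
   F >= <u, v> / (1 - <u, x>) for every unit vector u, with equality only for v = F (u - x).
   The right-hand side is the derivative of -ln (1 - <u, x>) along v, so these functions calibrate
   the unit speed rays u - exp(-t) w running towards u.  A locally minimising curve of speed k
   therefore satisfies x' = k (u - x) with a locally constant, hence constant, u.  The maximal
   geodesics are thus parametrised by full chords, and f turns the chord <a, x> = b into
   2 <a, y> = b (1 + |y|^2): a diameter for b = 0, and otherwise the circle with centre z = a / b
   and radius r where |z|^2 = 1 + r^2, i.e. a circle orthogonal to the unit circle. *)

theory Submission
  imports Defs
begin

subsection \<open>The inverse of the isometry\<close>

text \<open>The passage from the Poincare model to the Beltrami-Klein model of the hyperbolic
  plane.\<close>

definition poincare_funk :: "real^2 \<Rightarrow> real^2" where
  "poincare_funk y = (2 / (1 + (norm y)\<^sup>2)) *\<^sub>R y"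

lemma norm_poincare_funk: "norm (poincare_funk y) = 2 * norm y / (1 + (norm y)\<^sup>2)"
  by (simp add: poincare_funk_def)

lemma poincare_funk_in_disc:
  assumes "y \<in> disc"
  shows "poincare_funk y \<in> disc"
proof -
  have "0 < (1 - norm y)\<^sup>2" using assms by simp
  then have "2 * norm y < 1 + (norm y)\<^sup>2" by (simp add: power2_eq_square algebra_simps)
  then show ?thesis by (simp add: norm_poincare_funk add_pos_nonneg)
qed

lemma norm_less_1_iff_power2: "norm x < 1 \<longleftrightarrow> (norm x)\<^sup>2 < 1"
  by (simp add: abs_square_less_1)

text \<open>With \<open>r = |y|^2\<close> the radicand is the square of
  \<open>(1 - r) / (1 + r)\<close>, and \<open>r < 1\<close> selects the sign of the root.\<close>

lemma funk_poincare_poincare_funk: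
  assumes "y \<in> disc"
  shows "funk_poincare (poincare_funk y) = y"
proof -
  define r where "r = (norm y)\<^sup>2"
  have r: "0 \<le> r" "r < 1" using assms by (simp_all add: r_def norm_less_1_iff_power2)
  have "(norm (poincare_funk y))\<^sup>2 = 4 * r / (1 + r)\<^sup>2"
    by (simp add: norm_poincare_funk r_def power_divide power_mult_distrib)
  moreover have "1 - 4 * r / (1 + r)\<^sup>2 = ((1 - r) / (1 + r))\<^sup>2"
  proof -
    have "(1 + r)\<^sup>2 - 4 * r = (1 - r)\<^sup>2" by (simp add: power2_eq_square algebra_simps)
    then show ?thesis using r by (simp add: divide_simps)
  qed
  ultimately have "sqrt (1 - (norm (poincare_funk y))\<^sup>2) = (1 - r) / (1 + r)"
    using r by simp
  then have "funk_poincare (poincare_funk y) = (1 / (1 + (1 - r) / (1 + r)) * (2 / (1 + r))) *\<^sub>R y"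
    by (simp add: funk_poincare_def poincare_funk_def r_def)
  also have "1 / (1 + (1 - r) / (1 + r)) * (2 / (1 + r)) = 1"
    using r by (simp add: field_simps)
  finally show ?thesis by simp
qed

lemma norm_funk_poincare_power2:
  assumes "x \<in> disc"
  defines "s \<equiv> sqrt (1 - (norm x)\<^sup>2)"
  shows "0 < s" "(norm (funk_poincare x))\<^sup>2 = (1 - s) / (1 + s)"
proof -
  have n: "(norm x)\<^sup>2 < 1" using assms norm_less_1_iff_power2[of x] by simp
  then show s: "0 < s" by (simp add: s_def)
  have "(norm x)\<^sup>2 = (1 - s) * (1 + s)"
    using n by (simp add: s_def algebra_simps)
  moreover have "(norm (funk_poincare x))\<^sup>2 = (norm x)\<^sup>2 / (1 + s)\<^sup>2"
    using s by (simp add: funk_poincare_def s_def[symmetric] power_divide)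
  ultimately show "(norm (funk_poincare x))\<^sup>2 = (1 - s) / (1 + s)"
    using s by (simp add: power2_eq_square)
qed

lemma funk_poincare_in_disc:
  assumes "x \<in> disc"
  shows "funk_poincare x \<in> disc"
  using norm_funk_poincare_power2[OF assms]
  by (simp add: norm_less_1_iff_power2[of "funk_poincare x"] del: real_sqrt_gt_0_iff)

lemma poincare_funk_funk_poincare:
  assumes "x \<in> disc"
  shows "poincare_funk (funk_poincare x) = x"
proof -
  define s where "s = sqrt (1 - (norm x)\<^sup>2)"
  note s = norm_funk_poincare_power2[OF assms, folded s_def]
  have "poincare_funk (funk_poincare x) = (2 / (1 + (1 - s) / (1 + s)) * (1 / (1 + s))) *\<^sub>R x"
    unfolding poincare_funk_def s(2) by (simp add: funk_poincare_def s_def)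
  also have "2 / (1 + (1 - s) / (1 + s)) * (1 / (1 + s)) = 1"
    using s(1) by (simp add: field_simps)
  finally show ?thesis by simp
qed

text \<open>The derivative in \<open>funk_poincare_isometry\<close> is only asserted to exist; its
  explicit form shows the continuous dependence on the base point that C1 curves require.\<close>

lemma funk_poincare_has_derivative:
  assumes x: "x \<in> disc"
  defines "s \<equiv> sqrt (1 - x \<bullet> x)"
  shows "(funk_poincare has_derivative
           (\<lambda>v. (1 / (1 + s)) *\<^sub>R v + ((x \<bullet> v) / (s * (1 + s)\<^sup>2)) *\<^sub>R x)) (at x)"
proof -
  have pos: "1 - x \<bullet> x > 0"
    using x by (simp add: norm_less_1_iff_power2 dot_square_norm)
  then have s: "s > 0" by (simp add: s_def)
  have eq: "funk_poincare = (\<lambda>y. (1 / (1 + sqrt (1 - y \<bullet> y))) *\<^sub>R y)"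
    by (auto simp: funk_poincare_def dot_square_norm)
  show ?thesis
    unfolding eq
    apply (rule derivative_eq_intros refl | (use pos s s_def in simp; fail))+
    using s by (auto simp: s_def[symmetric] inner_commute divide_simps power2_eq_square fun_eq_iff)
qed

lemma poincare_funk_differentiable: "poincare_funk differentiable (at y)"
proof -
  have eq: "poincare_funk = (\<lambda>y. (2 / (1 + y \<bullet> y)) *\<^sub>R y)"
    by (auto simp: poincare_funk_def dot_square_norm)
  have "1 + y \<bullet> y \<noteq> 0" by (metis add_pos_nonneg inner_ge_zero less_irrefl zero_less_one)
  then show ?thesis unfolding eq by (intro derivative_intros) auto
qed

section \<open>Curves and their speeds under the isometry and its inverse\<close>

lemma funk_poincare_path_speed:
  assumes x: "(x has_vector_derivative v) (at t)" "x t \<in> disc"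
  shows "\<exists>w. ((\<lambda>t. funk_poincare (x t)) has_vector_derivative w) (at t)
           \<and> poincare_metric (funk_poincare (x t)) w = funk_metric (x t) v"
proof -
  obtain D where D: "(funk_poincare has_derivative D) (at (x t))"
      "\<And>v. poincare_metric (funk_poincare (x t)) (D v) = funk_metric (x t) v"
    using funk_poincare_isometry[OF x(2)] by blast
  have "((funk_poincare \<circ> x) has_vector_derivative D v) (at t)"
    by (rule vector_derivative_diff_chain_within[OF x(1)])
      (use D(1) in \<open>auto intro: has_derivative_at_withinI\<close>)
  then show ?thesis using D(2) by (auto simp: o_def)
qed

text \<open>Near \<open>c t\<close> the two maps compose to the identity, so uniqueness of
  derivatives makes \<open>D \<circ> G\<close> the identity. The isometry property of
  \<open>D\<close> at \<open>G v\<close> is then the claim for \<open>v\<close>.\<close>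

lemma poincare_funk_path_speed:
  assumes c: "(c has_vector_derivative v) (at t)" "c t \<in> disc"
  shows "\<exists>w. ((\<lambda>t. poincare_funk (c t)) has_vector_derivative w) (at t)
           \<and> poincare_metric (c t) v = funk_metric (poincare_funk (c t)) w"
proof -
  obtain G where G: "(poincare_funk has_derivative G) (at (c t))"
    using poincare_funk_differentiable by (auto simp: differentiable_def)
  have x: "((poincare_funk \<circ> c) has_vector_derivative G v) (at t)"
    by (rule vector_derivative_diff_chain_within[OF c(1)])
      (use G in \<open>auto intro: has_derivative_at_withinI\<close>)
  obtain D where D: "(funk_poincare has_derivative D) (at (poincare_funk (c t)))"
      "\<And>v. poincare_metric (funk_poincare (poincare_funk (c t))) (D v)
            = funk_metric (poincare_funk (c t)) v"
    using funk_poincare_isometry[OF poincare_funk_in_disc[OF c(2)]] by blast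
  have "((funk_poincare \<circ> poincare_funk) has_derivative (D \<circ> G)) (at (c t))"
    by (rule diff_chain_at[OF G D(1)])
  then have "((\<lambda>y. y) has_derivative (D \<circ> G)) (at (c t))"
    by (rule has_derivative_transform_within_open[where s = disc])
      (use c(2) in \<open>auto simp del: mem_ball simp: funk_poincare_poincare_funk\<close>)
  then have "D \<circ> G = (\<lambda>y. y)" using has_derivative_ident has_derivative_unique by blast
  then have "D (G v) = v" by (metis o_apply)
  then show ?thesis
    using x D(2)[of "G v"] c(2) by (auto simp: o_def funk_poincare_poincare_funk simp del: mem_ball)
qed

subsection \<open>Calibration of the Funk metric\<close>

text \<open>\<^term>\<open>x + v /\<^sub>R funk_metric x v\<close> is the point where the ray from \<^term>\<open>x\<close>
  in direction \<^term>\<open>v \<noteq> 0\<close> leaves the disc.\<close>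

lemma funk_metric_exit:
  assumes "x \<in> disc"
  shows "norm (funk_metric x v *\<^sub>R x + v) = funk_metric x v" "0 \<le> funk_metric x v"
proof -
  define r a where "r = 1 - (norm x)\<^sup>2" and "a = x \<bullet> v"
  define q where "q = sqrt (r * (norm v)\<^sup>2 + a\<^sup>2)"
  have r: "r > 0" using assms norm_less_1_iff_power2[of x] by (simp add: r_def)
  have q2: "q\<^sup>2 = r * (norm v)\<^sup>2 + a\<^sup>2" using r by (simp add: q_def)
  have "\<bar>a\<bar> \<le> q" unfolding q_def using r by (intro real_le_rsqrt) auto
  moreover have F: "funk_metric x v = (q + a) / r"
    by (simp add: funk_metric_def q_def r_def a_def add_divide_distrib)
  ultimately show F0: "0 \<le> funk_metric x v" using r by simp
  define F where "F = funk_metric x v"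
  have Fr: "F * r = q + a" using r F F_def by simp
  \<comment> \<open>Squaring \<open>F * r - a = q\<close>. After cancelling \<open>r\<close>, this
    is the quadratic equation for \<open>F\<close> that expresses
    \<open>|F x + v| = F\<close>.\<close>
  have "r * (r * F\<^sup>2) = r * (2 * F * a + (norm v)\<^sup>2)"
    using Fr q2 by algebra
  then have "r * F\<^sup>2 = 2 * F * a + (norm v)\<^sup>2" using r by simp
  then have "(norm (F *\<^sub>R x + v))\<^sup>2 = F\<^sup>2"
    by (simp add: power2_norm_eq_inner inner_add_left inner_add_right inner_commute[of v x]
        r_def a_def algebra_simps) (simp add: power2_eq_square mult_ac)
  then show "norm (F *\<^sub>R x + v) = F"
    using F0 F_def by (metis norm_ge_zero power2_eq_iff_nonneg)
qed

lemma inner_disc_less_1: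
  fixes x u :: "'a::real_inner"
  assumes "norm x < 1" "norm u = 1"
  shows "u \<bullet> x < 1"
  using norm_cauchy_schwarz[of u x] assms by simp

text \<open>Cauchy-Schwarz for \<open>u\<close> and \<open>F x + v\<close>, a vector of norm
  \<open>F\<close>.\<close>

lemma funk_metric_calibration:
  assumes "x \<in> disc" "norm u = 1"
  shows "(u \<bullet> v) / (1 - u \<bullet> x) \<le> funk_metric x v"
proof -
  have "u \<bullet> (funk_metric x v *\<^sub>R x + v) \<le> funk_metric x v"
    using norm_cauchy_schwarz[of u "funk_metric x v *\<^sub>R x + v"] funk_metric_exit[OF assms(1)] assms
    by simp
  moreover have "u \<bullet> x < 1" using inner_disc_less_1 assms by auto
  ultimately show ?thesis by (simp add: field_simps inner_add_right)
qed

text \<open>Equality in Cauchy-Schwarz makes \<open>F x + v\<close> a nonnegative multiple of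
  \<open>u\<close>; as its norm is \<open>F\<close>, it is \<open>F u\<close>.\<close>

lemma funk_metric_calibration_eq:
  assumes x: "x \<in> disc" and u: "norm u = 1"
    and eq: "(u \<bullet> v) / (1 - u \<bullet> x) = funk_metric x v"
  shows "v = funk_metric x v *\<^sub>R (u - x)"
proof -
  define F where "F = funk_metric x v"
  have F: "norm (F *\<^sub>R x + v) = F" "0 \<le> F" using funk_metric_exit[OF x] F_def by auto
  have "u \<bullet> x < 1" using inner_disc_less_1 assms by auto
  then have "u \<bullet> v = F * (1 - u \<bullet> x)" using eq F_def by (auto simp: field_simps)
  then have "u \<bullet> (F *\<^sub>R x + v) = norm u * norm (F *\<^sub>R x + v)"
    using F u by (simp add: inner_add_right algebra_simps)
  then have "F *\<^sub>R x + v = F *\<^sub>R u"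
    unfolding norm_cauchy_schwarz_eq using F u by simp
  then show ?thesis unfolding F_def[symmetric] by (simp add: algebra_simps)
qed

text \<open>A converse to the equality case. The radicand collapses to the square of
  \<open>k * (1 - a)\<close>, where \<open>1 - a > 0\<close> because \<open>x\<close> lies in the
  disc.\<close>

lemma funk_metric_towards:
  assumes x: "x \<in> disc" and u: "norm u = 1" and k: "0 \<le> k"
  shows "funk_metric x (k *\<^sub>R (u - x)) = k"
proof -
  define r a where "r = (norm x)\<^sup>2" and "a = x \<bullet> u"
  have r: "r < 1" using x norm_less_1_iff_power2[of x] by (simp add: r_def)
  have a: "a < 1" using inner_disc_less_1[of x u] x u by (simp add: a_def inner_commute)
  have uu: "u \<bullet> u = 1" and xx: "x \<bullet> x = r" using u by (auto simp: dot_square_norm r_def)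
  have "(norm (u - x))\<^sup>2 = 1 - 2 * a + r"
    by (simp add: power2_norm_eq_inner inner_diff_left inner_diff_right uu xx a_def inner_commute)
  moreover have "x \<bullet> (u - x) = a - r" by (simp add: inner_diff_right a_def xx)
  ultimately have "(1 - r) * (norm (k *\<^sub>R (u - x)))\<^sup>2 + (x \<bullet> (k *\<^sub>R (u - x)))\<^sup>2
      = (1 - r) * (k\<^sup>2 * (1 - 2 * a + r)) + (k * (a - r))\<^sup>2"
    by (simp add: power_mult_distrib)
  also have "\<dots> = (k * (1 - a))\<^sup>2" by (simp add: power2_eq_square algebra_simps)
  finally have "sqrt ((1 - r) * (norm (k *\<^sub>R (u - x)))\<^sup>2 + (x \<bullet> (k *\<^sub>R (u - x)))\<^sup>2) = k * (1 - a)"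
    using k a by simp
  then have "funk_metric x (k *\<^sub>R (u - x)) = k * (1 - a) / (1 - r) + k * (a - r) / (1 - r)"
    using \<open>x \<bullet> (u - x) = a - r\<close> by (simp add: funk_metric_def r_def)
  also have "\<dots> = k"
    using r by (simp add: add_divide_distrib[symmetric] distrib_left[symmetric])
  finally show ?thesis .
qed


subsection \<open>Funk rays and distances\<close>

text \<open>The solution of \<open>x' = k (u - x)\<close> with \<open>x 0 = u - w\<close>. For
  \<open>k > 0\<close> it moves along a line and approaches \<open>u\<close> only as
  \<open>t\<close> tends to infinity.\<close>

definition funk_ray :: "real^2 \<Rightarrow> real^2 \<Rightarrow> real \<Rightarrow> real \<Rightarrow> real^2" where
  "funk_ray u w k t = u - exp (- (k * t)) *\<^sub>R w"

lemma funk_ray_has_vector_derivative: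
  "(funk_ray u w k has_vector_derivative k *\<^sub>R (u - funk_ray u w k t)) (at t within S)"
  unfolding funk_ray_def
  by (rule derivative_eq_intros refl | simp)+

lemma continuous_on_funk_ray: "continuous_on S (funk_ray u w k)"
  unfolding funk_ray_def by (intro continuous_intros)

text \<open>Affine changes of parameter stay within the family, which reduces distances over
  \<open>[a, b]\<close> to \<open>[0, 1]\<close>.\<close>

lemma funk_ray_shift: "funk_ray u w k (a + l * t) = funk_ray u (exp (- (k * a)) *\<^sub>R w) (k * l) t"
  by (simp add: funk_ray_def algebra_simps flip: exp_add)

text \<open>With \<open>e = exp (- (k * t))\<close>, the number \<open>|u - e w|^2 - 1\<close> is
  the product of \<open>e > 0\<close> and \<open>e |w|^2 - 2 <u, w>\<close>, so the sign of the
  second factor decides.\<close>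

lemma funk_ray_in_disc_iff:
  assumes "norm u = 1" "w \<noteq> 0"
  shows "funk_ray u w k t \<in> disc \<longleftrightarrow> exp (- (k * t)) * (norm w)\<^sup>2 < 2 * (u \<bullet> w)"
    and "norm (funk_ray u w k t) = 1 \<longleftrightarrow> exp (- (k * t)) * (norm w)\<^sup>2 = 2 * (u \<bullet> w)"
proof -
  define e where "e = exp (- (k * t))"
  have e: "e > 0" by (simp add: e_def)
  have "u \<bullet> u = 1" using assms by (simp add: dot_square_norm)
  then have n: "(norm (funk_ray u w k t))\<^sup>2 = 1 + e * (e * (norm w)\<^sup>2 - 2 * (u \<bullet> w))"
    unfolding funk_ray_def e_def[symmetric] power2_norm_eq_inner
    by (simp add: inner_diff_left inner_diff_right inner_commute[of w u] algebra_simps)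
  show "funk_ray u w k t \<in> disc \<longleftrightarrow> exp (- (k * t)) * (norm w)\<^sup>2 < 2 * (u \<bullet> w)"
    using e unfolding e_def[symmetric]
    by (simp add: norm_less_1_iff_power2[of "funk_ray u w k t"] n mult_less_0_iff)
  have "norm (funk_ray u w k t) = 1 \<longleftrightarrow> (norm (funk_ray u w k t))\<^sup>2 = 1"
    by (simp add: power2_eq_1_iff) (smt (verit) norm_ge_zero)
  then show "norm (funk_ray u w k t) = 1 \<longleftrightarrow> exp (- (k * t)) * (norm w)\<^sup>2 = 2 * (u \<bullet> w)"
    using e unfolding e_def[symmetric] n by simp
qed

lemma funk_ray_nonzero:
  assumes "norm u = 1" "funk_ray u w k t \<in> disc"
  shows "w \<noteq> 0"
  using assms by (auto simp: funk_ray_def)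

lemma funk_ray_stays_in_disc:
  assumes "norm u = 1" "0 \<le> k" "funk_ray u w k s \<in> disc" "s \<le> t"
  shows "funk_ray u w k t \<in> disc"
proof -
  have w: "w \<noteq> 0" using assms funk_ray_nonzero by blast
  have "exp (- (k * t)) * (norm w)\<^sup>2 \<le> exp (- (k * s)) * (norm w)\<^sup>2"
    using assms by (intro mult_right_mono) (auto intro: mult_left_mono)
  then show ?thesis
    using assms(3) unfolding funk_ray_in_disc_iff(1)[OF assms(1) w] by linarith
qed

lemma funk_poincare_ray_C1:
  assumes "\<And>t. t \<in> S \<Longrightarrow> funk_ray u w k t \<in> disc"
  shows "(\<lambda>t. funk_poincare (funk_ray u w k t)) C1_differentiable_on S"
proof -
  define x v where "x = funk_ray u w k" and "v = (\<lambda>t. k *\<^sub>R (u - funk_ray u w k t))"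
  define s where "s = (\<lambda>t. sqrt (1 - x t \<bullet> x t))"
  have xS: "x t \<in> disc" if "t \<in> S" for t using assms that x_def by simp
  have s: "s t > 0" if "t \<in> S" for t
    using xS[OF that] by (simp add: s_def dot_square_norm norm_less_1_iff_power2)
  have c: "continuous_on S x" "continuous_on S v"
    unfolding x_def v_def by (intro continuous_intros continuous_on_funk_ray)+
  then have cs: "continuous_on S s" unfolding s_def by (intro continuous_intros)
  have "((\<lambda>t. funk_poincare (x t)) has_vector_derivative
          (1 / (1 + s t)) *\<^sub>R v t + ((x t \<bullet> v t) / (s t * (1 + s t)\<^sup>2)) *\<^sub>R x t) (at t)"
    if "t \<in> S" for t
  proof -
    have "(x has_vector_derivative v t) (at t)"
      unfolding x_def v_def by (rule funk_ray_has_vector_derivative)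
    from vector_derivative_diff_chain_within[OF this
        has_derivative_at_withinI[OF funk_poincare_has_derivative[OF xS[OF that]]]]
    show ?thesis by (simp add: o_def s_def)
  qed
  moreover have "continuous_on S
      (\<lambda>t. (1 / (1 + s t)) *\<^sub>R v t + ((x t \<bullet> v t) / (s t * (1 + s t)\<^sup>2)) *\<^sub>R x t)"
    using s by (intro continuous_intros c cs) (force simp: add_pos_pos)+
  ultimately show ?thesis unfolding C1_differentiable_on_def x_def[symmetric]
    by (intro exI conjI ballI)
qed

lemma funk_poincare_ray_speed:
  assumes "norm u = 1" "0 \<le> k" "funk_ray u w k t \<in> disc"
  defines "c \<equiv> \<lambda>t. funk_poincare (funk_ray u w k t)"
  shows "poincare_metric (c t) (vector_derivative c (at t)) = k"
proof -
  obtain v where "(c has_vector_derivative v) (at t)"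
    "poincare_metric (c t) v = funk_metric (funk_ray u w k t) (k *\<^sub>R (u - funk_ray u w k t))"
    using funk_poincare_path_speed[OF funk_ray_has_vector_derivative assms(3)] c_def by blast
  then show ?thesis using funk_metric_towards assms by (simp add: vector_derivative_at)
qed

text \<open>Collects, at one parameter, the Funk velocity \<open>w\<close>, the derivative of the
  calibrating potential and the speed. It serves both the lower bound on lengths and the equality
  case for minimisers.\<close>

lemma poincare_speed_calibration:
  assumes c: "(c has_vector_derivative v) (at t)" "c t \<in> disc" and u: "norm u = 1"
  obtains w where "((\<lambda>t. poincare_funk (c t)) has_vector_derivative w) (at t)"
    "((\<lambda>t. - ln (1 - u \<bullet> poincare_funk (c t))) has_vector_derivative
       (u \<bullet> w) / (1 - u \<bullet> poincare_funk (c t))) (at t)"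
    "poincare_metric (c t) v = funk_metric (poincare_funk (c t)) w"
proof -
  obtain w where w: "((\<lambda>t. poincare_funk (c t)) has_vector_derivative w) (at t)"
      "poincare_metric (c t) v = funk_metric (poincare_funk (c t)) w"
    using poincare_funk_path_speed[OF c] by blast
  have "u \<bullet> poincare_funk (c t) < 1"
    using inner_disc_less_1[OF _ u] poincare_funk_in_disc[OF c(2)] by simp
  moreover have "((\<lambda>t. u \<bullet> poincare_funk (c t)) has_real_derivative u \<bullet> w) (at t)"
    using bounded_linear.has_vector_derivative[OF bounded_linear_inner_right w(1), of u]
    by (simp add: has_real_derivative_iff_has_vector_derivative)
  ultimately have "((\<lambda>t. - ln (1 - u \<bullet> poincare_funk (c t))) has_real_derivative
       (u \<bullet> w) / (1 - u \<bullet> poincare_funk (c t))) (at t)"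
    by (auto intro!: derivative_eq_intros)
  then show ?thesis
    using that w by (simp add: has_real_derivative_iff_has_vector_derivative)
qed

text \<open>The left-hand side is the integral of the derivative of the potential along the curve,
  which \<open>funk_metric_calibration\<close> bounds pointwise by the speed.\<close>

lemma poincare_length_calibration:
  assumes g: "valid_path g" "path_image g \<subseteq> disc" and u: "norm u = 1"
    and L: "has_finsler_length poincare_metric g 0 1 L"
  shows "ln (1 - u \<bullet> poincare_funk (pathstart g)) - ln (1 - u \<bullet> poincare_funk (pathfinish g)) \<le> L"
proof -
  define p where "p = (\<lambda>t. - ln (1 - u \<bullet> poincare_funk (g t)))"
  define F where "F = (\<lambda>t. poincare_metric (g t) (vector_derivative g (at t)))"
  obtain S where S: "finite S" "g C1_differentiable_on ({0..1} - S)" and cont: "continuous_on {0..1} g"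
    using g(1) unfolding valid_path_def piecewise_C1_differentiable_on_def by blast
  have gd: "g t \<in> disc" if "t \<in> {0..1}" for t
    using g(2) that unfolding path_image_def by blast
  have "continuous_on {0..1} (\<lambda>t. poincare_funk (g t))"
    using continuous_on_compose[OF cont, of poincare_funk] poincare_funk_differentiable
    by (simp add: o_def continuous_at_imp_continuous_on differentiable_imp_continuous_within)
  then have contp: "continuous_on {0..1} p"
    unfolding p_def using inner_disc_less_1[OF _ u] gd[THEN poincare_funk_in_disc]
    by (intro continuous_intros) force+
  have "\<exists>q. (p has_vector_derivative q) (at t) \<and> q \<le> F t" if t: "t \<in> {0<..<1} - S" for t
  proof -
    obtain v where v: "(g has_vector_derivative v) (at t)"
      using S(2) t unfolding C1_differentiable_on_def by (force simp: greaterThanLessThan_def)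
    have gt: "g t \<in> disc" using gd t by auto
    obtain w where w: "(p has_vector_derivative (u \<bullet> w) / (1 - u \<bullet> poincare_funk (g t))) (at t)"
        "poincare_metric (g t) v = funk_metric (poincare_funk (g t)) w"
      using poincare_speed_calibration[OF v gt u] p_def by blast
    then show ?thesis
      using funk_metric_calibration[OF poincare_funk_in_disc[OF gt] u, of w] v
      by (auto simp: F_def vector_derivative_at)
  qed
  then obtain q where q: "\<And>t. t \<in> {0<..<1} - S \<Longrightarrow> (p has_vector_derivative q t) (at t) \<and> q t \<le> F t"
    by metis
  \<comment> \<open>At the exceptional parameters and the end points the value \<open>F t\<close> is
    inserted, so that \<open>q' \<le> F\<close> holds on all of \<open>[0, 1]\<close>; the
    fundamental theorem only needs continuity of \<open>p\<close> there.\<close>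
  define q' where "q' = (\<lambda>t. if t \<in> {0<..<1} - S then q t else F t)"
  have "(q' has_integral p 1 - p 0) {0..1}"
    by (rule fundamental_theorem_of_calculus_interior_strong[OF S(1)]) (use q contp q'_def in auto)
  moreover have "(F has_integral L) {0..1}"
    using L by (simp add: has_finsler_length_def F_def)
  ultimately have "p 1 - p 0 \<le> L"
    by (rule has_integral_le) (use q q'_def in auto)
  then show ?thesis by (simp add: p_def pathstart_def pathfinish_def)
qed

text \<open>The image of the ray has constant speed \<open>k\<close> on \<open>[0, 1]\<close>, and
  calibration towards its own target \<open>u\<close> shows that no path is shorter. The case
  \<open>k = 0\<close>, a constant ray, gives the distance from a point to itself.\<close>

lemma finsler_dist_unit_ray:
  assumes u: "norm u = 1" and k: "0 \<le> k" and d: "funk_ray u w k 0 \<in> disc"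
  shows "finsler_dist poincare_metric disc
           (funk_poincare (funk_ray u w k 0)) (funk_poincare (funk_ray u w k 1)) = k"
  unfolding finsler_dist_def
proof (rule cInf_eq_minimum)
  define g where "g = (\<lambda>t. funk_poincare (funk_ray u w k t))"
  have dt: "funk_ray u w k t \<in> disc" if "0 \<le> t" for t
    using funk_ray_stays_in_disc[OF u k d that] .
  have "valid_path g"
    unfolding valid_path_def g_def
    by (intro C1_differentiable_imp_piecewise funk_poincare_ray_C1 dt) auto
  moreover have "path_image g \<subseteq> disc"
    using funk_poincare_in_disc dt by (auto simp: path_image_def g_def simp del: mem_ball_0)
  moreover have "has_finsler_length poincare_metric g 0 1 k"
  proof -
    have "((\<lambda>t. k) has_integral k) {0..1::real}"
      using has_integral_const_real[of k 0 1] by simp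
    moreover have "poincare_metric (g t) (vector_derivative g (at t)) = k" if "t \<in> {0..1}" for t
      unfolding g_def using funk_poincare_ray_speed[OF u k dt] that by simp
    ultimately show ?thesis unfolding has_finsler_length_def
      by (subst has_integral_cong) auto
  qed
  ultimately show "k \<in> {L. \<exists>g. valid_path g \<and> path_image g \<subseteq> disc
      \<and> pathstart g = funk_poincare (funk_ray u w k 0)
      \<and> pathfinish g = funk_poincare (funk_ray u w k 1)
      \<and> has_finsler_length poincare_metric g 0 1 L}"
    by (auto simp: pathstart_def pathfinish_def g_def intro!: exI[of _ g])
  fix L
  assume "L \<in> {L. \<exists>g. valid_path g \<and> path_image g \<subseteq> disc
      \<and> pathstart g = funk_poincare (funk_ray u w k 0)
      \<and> pathfinish g = funk_poincare (funk_ray u w k 1)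
      \<and> has_finsler_length poincare_metric g 0 1 L}"
  then obtain g where g: "valid_path g" "path_image g \<subseteq> disc" "has_finsler_length poincare_metric g 0 1 L"
    "pathstart g = funk_poincare (funk_ray u w k 0)"
    "pathfinish g = funk_poincare (funk_ray u w k 1)"
    by blast
  have uu: "u \<bullet> u = 1" using u by (simp add: dot_square_norm)
  have uw: "u \<bullet> w > 0"
    using inner_disc_less_1[of "funk_ray u w k 0" u] d u by (simp add: funk_ray_def inner_diff_right uu)
  \<comment> \<open>Along the ray, \<open>1 - <u, x>\<close> equals
    \<open>exp (- (k * t)) * (u \<bullet> w)\<close>, so the potential grows by exactly
    \<open>k\<close>.\<close>
  have "ln (u \<bullet> w) - ln (exp (- k) * (u \<bullet> w)) \<le> L"
    using poincare_length_calibration[OF g(1,2) u g(3)] dt[of 0] dt[of 1] g(4,5)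
    by (simp add: poincare_funk_funk_poincare funk_ray_def inner_diff_right uu del: mem_ball_0)
  then show "k \<le> L" using uw by (simp add: ln_mult)
qed

lemma finsler_dist_ray:
  assumes u: "norm u = 1" and k: "0 \<le> k" and d: "funk_ray u w k a \<in> disc" and ab: "a \<le> b"
  shows "finsler_dist poincare_metric disc
           (funk_poincare (funk_ray u w k a)) (funk_poincare (funk_ray u w k b)) = k * (b - a)"
proof -
  define w' where "w' = exp (- (k * a)) *\<^sub>R w"
  have "funk_ray u w' (k * (b - a)) 0 = funk_ray u w k a"
    "funk_ray u w' (k * (b - a)) 1 = funk_ray u w k b"
    using funk_ray_shift[of u w k a "b - a"] by (simp_all add: w'_def flip: funk_ray_shift)
  then show ?thesis
    using finsler_dist_unit_ray[OF u, of "k * (b - a)" w'] k d ab by simp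
qed

subsection \<open>Geodesics\<close>

lemma disc_ray_exit:
  assumes "x \<in> disc" "d \<noteq> 0"
  obtains r where "0 < r" "norm (x + r *\<^sub>R d) = 1"
proof -
  obtain r where "0 < r" "x + r *\<^sub>R d \<in> frontier disc"
    using ray_to_frontier[of disc x d] assms by (auto simp: interior_open)
  then show ?thesis using that by (simp add: frontier_ball)
qed

lemma funk_ray_through:
  assumes x: "x \<in> disc" and y: "y \<in> disc" and "x \<noteq> y"
  obtains u w k where "norm u = 1" "0 < k" "funk_ray u w k 0 = x" "funk_ray u w k 1 = y"
proof -
  obtain r where r: "0 < r" "norm (x + r *\<^sub>R (y - x)) = 1"
    using disc_ray_exit[OF x, of "y - x"] assms by auto
  define u where "u = x + r *\<^sub>R (y - x)"
  \<comment> \<open>If \<open>r \<le> 1\<close>, the exit point \<open>u\<close> would lie on the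
    segment from \<open>x\<close> to \<open>y\<close>, hence inside the disc.\<close>
  have "1 < r"
  proof (rule ccontr)
    assume "\<not> 1 < r"
    then have "(1 - r) *\<^sub>R x + r *\<^sub>R y \<in> disc"
      using convexD[OF convex_ball x y, of "1 - r" r] r(1) by simp
    then show False using r(2) by (simp add: algebra_simps)
  qed
  then have e: "0 < 1 - 1 / r" "1 - 1 / r < 1" by auto
  \<comment> \<open>\<open>y\<close> lies at the fraction \<open>1 / r\<close> of the way from
    \<open>x\<close> to \<open>u\<close>, so \<open>exp (- k)\<close> has to be the remaining
    fraction \<open>1 - 1 / r\<close>.\<close>
  define k where "k = - ln (1 - 1 / r)"
  have "funk_ray u (u - x) k 0 = x" by (simp add: funk_ray_def)
  moreover have "funk_ray u (u - x) k 1 = y"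
  proof -
    have "funk_ray u (u - x) k 1 = u - (1 - 1 / r) *\<^sub>R (u - x)"
      using e by (simp add: funk_ray_def k_def)
    also have "\<dots> = x + (1 / r) *\<^sub>R (u - x)" by (simp add: scaleR_diff_left)
    also have "\<dots> = y" using \<open>1 < r\<close> by (simp add: u_def)
    finally show ?thesis .
  qed
  moreover have "0 < k" using e by (simp add: k_def ln_less_zero)
  ultimately show ?thesis using that[of u k "u - x"] r(2) u_def by simp
qed

text \<open>The ray from \<open>x a\<close> through \<open>x b\<close> supplies \<open>u\<close>.
  The length and the gain of the potential of \<open>u\<close> over \<open>[a, b]\<close> are both
  \<open>k * (b - a)\<close>, so calibration is an equality at each interior parameter and
  determines the velocity.\<close>

lemma minimizing_curve_direction:
  assumes ab: "a < b" and k: "0 < k"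
    and c: "\<And>t. t \<in> {a..b} \<Longrightarrow> (c has_vector_derivative v t) (at t)"
    and cd: "\<And>t. t \<in> {a..b} \<Longrightarrow> c t \<in> disc"
    and speed: "\<And>t. t \<in> {a..b} \<Longrightarrow> poincare_metric (c t) (v t) = k"
    and len: "has_finsler_length poincare_metric c a b (finsler_dist poincare_metric disc (c a) (c b))"
  obtains u where "norm u = 1"
    "\<And>t. t \<in> {a<..<b} \<Longrightarrow>
      ((\<lambda>t. poincare_funk (c t)) has_vector_derivative k *\<^sub>R (u - poincare_funk (c t))) (at t)"
proof -
  define x where "x = (\<lambda>t. poincare_funk (c t))"
  have xd: "x t \<in> disc" "funk_poincare (x t) = c t" if "t \<in> {a..b}" for t
    using cd[OF that] poincare_funk_in_disc funk_poincare_poincare_funk x_def by auto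
  have "((\<lambda>t. k) has_integral k * (b - a)) {a..b}"
    using has_integral_const_real[of k a b] ab by (simp add: mult.commute)
  moreover have "poincare_metric (c t) (vector_derivative c (at t)) = k" if "t \<in> {a..b}" for t
    using speed[OF that] vector_derivative_at[OF c[OF that]] by simp
  ultimately have "has_finsler_length poincare_metric c a b (k * (b - a))"
    unfolding has_finsler_length_def by (subst has_integral_cong) auto
  then have dist: "finsler_dist poincare_metric disc (c a) (c b) = k * (b - a)"
    using len has_integral_unique unfolding has_finsler_length_def by blast
  \<comment> \<open>Otherwise the constant ray would give distance 0, whereas
    \<open>k * (b - a)\<close> is positive.\<close>
  have "x a \<noteq> x b"
  proof
    assume "x a = x b"
    obtain u :: "real^2" where u: "norm u = 1" using vector_choose_size[of 1] by auto
    have "funk_ray u (u - x a) 0 t = x a" for t by (simp add: funk_ray_def)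
    then have "finsler_dist poincare_metric disc (c a) (c b) = 0"
      using finsler_dist_unit_ray[OF u, of 0 "u - x a"] xd[of a] xd[of b] ab \<open>x a = x b\<close> by simp
    then show False using dist k ab by simp
  qed
  moreover have "x a \<in> disc" "x b \<in> disc" using xd(1)[of a] xd(1)[of b] ab by simp_all
  ultimately obtain u w m
    where u: "norm u = 1" "0 < m" "funk_ray u w m 0 = x a" "funk_ray u w m 1 = x b"
    using funk_ray_through by metis
  \<comment> \<open>Both sides are the distance from \<open>c a\<close> to
    \<open>c b\<close>.\<close>
  then have m: "m = k * (b - a)"
    using finsler_dist_unit_ray[of u m w] dist xd[of a] xd[of b] ab by simp
  define p where "p = (\<lambda>t. - ln (1 - u \<bullet> x t))"
  have uu: "u \<bullet> u = 1" using u by (simp add: dot_square_norm)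
  have ux: "1 - u \<bullet> x a = u \<bullet> w" "1 - u \<bullet> x b = exp (- m) * (u \<bullet> w)"
    unfolding u(3,4)[symmetric] by (simp_all add: funk_ray_def inner_diff_right uu)
  have "u \<bullet> w > 0" using inner_disc_less_1[of "x a" u] xd[of a] ux u ab by simp
  then have p: "p b - p a = k * (b - a)" by (simp add: p_def ux ln_mult m)
  have "\<forall>t\<in>{a..b}. \<exists>w. (x has_vector_derivative w) (at t)
      \<and> (p has_vector_derivative (u \<bullet> w) / (1 - u \<bullet> x t)) (at t) \<and> funk_metric (x t) w = k"
  proof
    fix t assume t: "t \<in> {a..b}"
    show "\<exists>w. (x has_vector_derivative w) (at t)
      \<and> (p has_vector_derivative (u \<bullet> w) / (1 - u \<bullet> x t)) (at t) \<and> funk_metric (x t) w = k"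
      unfolding x_def p_def
      by (rule poincare_speed_calibration[OF c[OF t] cd[OF t] u(1)]) (use speed[OF t] in auto)
  qed
  then obtain X where X: "\<And>t. t \<in> {a..b} \<Longrightarrow> (x has_vector_derivative X t) (at t)"
      "\<And>t. t \<in> {a..b} \<Longrightarrow> (p has_real_derivative (u \<bullet> X t) / (1 - u \<bullet> x t)) (at t)"
      "\<And>t. t \<in> {a..b} \<Longrightarrow> funk_metric (x t) (X t) = k"
    by (metis has_real_derivative_iff_has_vector_derivative)
  \<comment> \<open>The derivative of \<open>h\<close> is the defect in the calibration inequality.
    It is nonnegative and \<open>h\<close> has equal end values, so \<open>h\<close> is
    constant.\<close>
  define h where "h = (\<lambda>t. k * t - p t)"
  have h': "(h has_real_derivative k - (u \<bullet> X t) / (1 - u \<bullet> x t)) (at t)" if "t \<in> {a..b}" for t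
    unfolding h_def by (rule derivative_eq_intros X(2)[OF that] refl | simp)+
  have mono: "h s \<le> h t" if "a \<le> s" "s \<le> t" "t \<le> b" for s t
  proof (rule DERIV_nonneg_imp_nondecreasing[OF that(2)])
    fix r assume "s \<le> r" "r \<le> t"
    then have r: "r \<in> {a..b}" using that by auto
    show "\<exists>y. DERIV h r :> y \<and> 0 \<le> y"
      using h'[OF r] funk_metric_calibration[OF xd(1)[OF r] u(1), of "X r"] X(3)[OF r] by auto
  qed
  have "h a = h b" using p by (simp add: h_def algebra_simps)
  then have hc: "h t = h a" if "t \<in> {a..b}" for t
    using mono[of a t] mono[of t b] that by auto
  have "X t = k *\<^sub>R (u - x t)" if t: "t \<in> {a<..<b}" for t
  proof -
    have tab: "t \<in> {a..b}" using t by auto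
    have "(h has_real_derivative 0) (at t)"
      by (rule has_field_derivative_transform_within_open[of "\<lambda>_. h a" _ _ "{a<..<b}"])
        (use t in \<open>auto intro: hc[symmetric]\<close>)
    from DERIV_unique[OF h'[OF tab] this]
    have "(u \<bullet> X t) / (1 - u \<bullet> x t) = funk_metric (x t) (X t)"
      using X(3)[OF tab] by simp
    from funk_metric_calibration_eq[OF xd(1)[OF tab] u(1) this]
    show ?thesis using X(3)[OF tab] by simp
  qed
  then have "(x has_vector_derivative k *\<^sub>R (u - x t)) (at t)" if "t \<in> {a<..<b}" for t
    using X(1)[of t] that by simp
  then show ?thesis using that[OF u(1)] unfolding x_def by simp
qed

text \<open>Each parameter has a neighbourhood with its own target point. \<open>U\<close> computes
  this target from position and velocity, so it is locally constant, and connectedness of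
  \<open>I\<close> leaves a single target.\<close>

lemma finsler_geodesic_imp_ray:
  assumes geo: "finsler_geodesic poincare_metric disc I c"
  obtains u w k where "norm u = 1" "0 < k"
    "\<And>t. t \<in> I \<Longrightarrow> funk_ray u w k t \<in> disc \<and> c t = funk_poincare (funk_ray u w k t)"
proof -
  note geo' = geo[unfolded finsler_geodesic_def]
  have I: "open I" "is_interval I" "I \<noteq> {}" and cI: "c ` I \<subseteq> disc" and C1: "c C1_differentiable_on I"
    and ex: "\<exists>k>0. \<forall>t\<in>I. poincare_metric (c t) (vector_derivative c (at t)) = k"
    and min: "\<forall>t\<in>I. \<exists>\<delta>>0. \<forall>a\<in>I \<inter> ball t \<delta>. \<forall>b\<in>I \<inter> ball t \<delta>. a \<le> b \<longrightarrow>
      has_finsler_length poincare_metric c a b (finsler_dist poincare_metric disc (c a) (c b))"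
    using geo' by simp_all
  have cd: "c t \<in> disc" if "t \<in> I" for t using cI that by blast
  obtain v where "(\<forall>t\<in>I. (c has_vector_derivative v t) (at t)) \<and> continuous_on I v"
    using C1 unfolding C1_differentiable_on_def ..
  then have v: "(c has_vector_derivative v t) (at t)" if "t \<in> I" for t
    using that by simp
  obtain k where k: "0 < k"
      "\<And>t. t \<in> I \<Longrightarrow> poincare_metric (c t) (vector_derivative c (at t)) = k"
    using ex by blast
  define x where "x = (\<lambda>t. poincare_funk (c t))"
  \<comment> \<open>Solves \<open>x' = k (u - x)\<close> for \<open>u\<close>.\<close>
  define U where "U = (\<lambda>t. x t + (1 / k) *\<^sub>R vector_derivative x (at t))"
  have loc: "\<exists>a b u. norm u = 1 \<and> t \<in> {a<..<b} \<and> (\<forall>s\<in>{a<..<b}.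
      U s = u \<and> (x has_vector_derivative k *\<^sub>R (u - x s)) (at s))" if t: "t \<in> I" for t
  proof -
    obtain d where d: "d > 0" "\<And>a b. a \<in> I \<inter> ball t d \<Longrightarrow> b \<in> I \<inter> ball t d \<Longrightarrow> a \<le> b \<Longrightarrow>
        has_finsler_length poincare_metric c a b (finsler_dist poincare_metric disc (c a) (c b))"
      using bspec[OF min t] by blast
    \<comment> \<open>A closed interval around \<open>t\<close> is taken, since minimality is
      applied between its two end points.\<close>
    have "open (I \<inter> ball t d)" "t \<in> I \<inter> ball t d" using I(1) t d(1) by auto
    then obtain e where e: "e > 0" "cball t e \<subseteq> I \<inter> ball t d"
      using open_contains_cball by metis
    define a b where "a = t - e" and "b = t + e"
    have "cball t e = {a..b}" by (simp add: a_def b_def cball_eq_atLeastAtMost)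
    moreover have "a < b" "t \<in> {a<..<b}" using e(1) by (auto simp: a_def b_def)
    moreover have "a \<in> {a..b}" "b \<in> {a..b}" using \<open>a < b\<close> by auto
    ultimately have ab: "a \<in> I \<inter> ball t d" "b \<in> I \<inter> ball t d" "a < b" "{a..b} \<subseteq> I" "t \<in> {a<..<b}"
      using e(2) by blast+
    obtain u where u: "norm u = 1"
        "\<And>s. s \<in> {a<..<b} \<Longrightarrow> (x has_vector_derivative k *\<^sub>R (u - x s)) (at s)"
      unfolding x_def
    proof (rule minimizing_curve_direction[of a b k c v])
      show "poincare_metric (c s) (v s) = k" if "s \<in> {a..b}" for s
        using k(2)[of s] vector_derivative_at[OF v, of s] that ab(4) by auto
      show "has_finsler_length poincare_metric c a b (finsler_dist poincare_metric disc (c a) (c b))"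
        using d(2) ab by simp
    qed (use ab k v cd in auto)
    have "U s = u" if "s \<in> {a<..<b}" for s
      using vector_derivative_at[OF u(2)[OF that]] k(1) by (simp add: U_def)
    then show ?thesis using u ab(5) by metis
  qed
  obtain t0 where t0: "t0 \<in> I" using I(3) by blast
  define u where "u = U t0"
  have Uc: "U t = u" if t: "t \<in> I" for t
  proof -
    have "\<forall>a\<in>I. eventually (\<lambda>b. U a = U b) (at a within I)"
    proof
      fix s assume "s \<in> I"
      then obtain a b u where "s \<in> {a<..<b}" "\<forall>s\<in>{a<..<b}. U s = u" using loc by meson
      then show "eventually (\<lambda>b. U s = U b) (at s within I)"
        unfolding eventually_at_topological by (intro exI[of _ "{a<..<b}"]) auto
    qed
    then show ?thesis
      unfolding u_def using connected_local_const[of I t t0 U] t t0 I(2) is_interval_connected by blast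
  qed
  have u1: "norm u = 1" using loc[OF t0] u_def by auto
  have x': "(x has_vector_derivative k *\<^sub>R (u - x t)) (at t)" if t: "t \<in> I" for t
    using loc[OF t] Uc[OF t] by metis
  \<comment> \<open>The integrating factor \<open>exp (k * t)\<close> turns the differential
    equation into a conserved quantity, which becomes the vector \<open>w\<close> of the
    ray.\<close>
  have const: "((\<lambda>t. exp (k * t) *\<^sub>R (u - x t)) has_vector_derivative 0) (at t within I)" if t: "t \<in> I" for t
    by (rule derivative_eq_intros has_vector_derivative_at_within[OF x'[OF t]] refl | simp)+
  have "\<exists>w. \<forall>t\<in>I. exp (k * t) *\<^sub>R (u - x t) = w"
    by (rule has_vector_derivative_zero_constant[OF is_interval_convex[OF I(2)] const],
        assumption, blast)
  then obtain w where w: "exp (k * t) *\<^sub>R (u - x t) = w" if "t \<in> I" for t by blast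
  have "funk_ray u w k t = x t" if "t \<in> I" for t
    unfolding w[OF that, symmetric] by (simp add: funk_ray_def flip: exp_add)
  then have "funk_ray u w k t \<in> disc \<and> c t = funk_poincare (funk_ray u w k t)" if "t \<in> I" for t
    using cd[OF that] that poincare_funk_in_disc funk_poincare_poincare_funk by (simp add: x_def)
  then show ?thesis by (rule that[OF u1 k(1)])
qed

lemma ray_imp_finsler_geodesic:
  assumes I: "open I" "is_interval I" "I \<noteq> {}" and u: "norm u = 1" and k: "0 < k"
    and d: "\<And>t. t \<in> I \<Longrightarrow> funk_ray u w k t \<in> disc"
  shows "finsler_geodesic poincare_metric disc I (\<lambda>t. funk_poincare (funk_ray u w k t))"
    (is "finsler_geodesic _ _ _ ?c")
proof -
  have speed: "poincare_metric (?c t) (vector_derivative ?c (at t)) = k" if "t \<in> I" for t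
    using funk_poincare_ray_speed[OF u _ d[OF that]] k by simp
  have "has_finsler_length poincare_metric ?c a b (finsler_dist poincare_metric disc (?c a) (?c b))"
    if ab: "a \<in> I" "b \<in> I" "a \<le> b" for a b
  proof -
    have "{a..b} \<subseteq> I" using mem_is_interval_1_I[OF I(2) ab(1,2)] by auto
    moreover have "((\<lambda>t. k) has_integral k * (b - a)) {a..b}"
      using has_integral_const_real[of k a b] ab by (simp add: mult.commute)
    ultimately have "has_finsler_length poincare_metric ?c a b (k * (b - a))"
      unfolding has_finsler_length_def using speed by (subst has_integral_cong) auto
    then show ?thesis using finsler_dist_ray[OF u _ d[OF ab(1)] ab(3)] k by simp
  qed
  \<comment> \<open>Rays minimise between any two of their points in \<open>I\<close>, so the radius
    is arbitrary, here 1.\<close>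
  then have "\<forall>t\<in>I. \<exists>\<delta>>0. \<forall>a\<in>I \<inter> ball t \<delta>. \<forall>b\<in>I \<inter> ball t \<delta>. a \<le> b \<longrightarrow>
      has_finsler_length poincare_metric ?c a b (finsler_dist poincare_metric disc (?c a) (?c b))"
    by (intro ballI exI[of _ 1]) simp
  moreover have "?c C1_differentiable_on I" by (rule funk_poincare_ray_C1) (rule d)
  moreover have "?c ` I \<subseteq> disc" using d funk_poincare_in_disc by blast
  moreover have "\<exists>k>0. \<forall>t\<in>I. poincare_metric (?c t) (vector_derivative ?c (at t)) = k"
    using k speed by (intro exI[of _ k]) simp
  ultimately show ?thesis
    unfolding finsler_geodesic_def using I by (intro conjI)
qed

subsection \<open>Maximal geodesics and chords\<close>

text \<open>The ray covers the points \<open>u - r w\<close> of the line with \<open>r > 0\<close>.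
  Points of the disc satisfy \<open><u, x> < 1\<close>, which together with
  \<open><u, w> > 0\<close> forces \<open>r > 0\<close>.\<close>

lemma funk_ray_range_disc:
  assumes u: "norm u = 1" and k: "0 < k" and d: "funk_ray u w k t0 \<in> disc"
  shows "range (funk_ray u w k) \<inter> disc = affine hull {u, u - w} \<inter> disc"
proof -
  have w: "w \<noteq> 0" using funk_ray_nonzero[OF u d] .
  have "0 \<le> exp (- (k * t0)) * (norm w)\<^sup>2" by simp
  then have uw: "u \<bullet> w > 0"
    using d unfolding funk_ray_in_disc_iff(1)[OF u w] by linarith
  have uu: "u \<bullet> u = 1" using u by (simp add: dot_square_norm)
  have "u - r *\<^sub>R w \<in> range (funk_ray u w k)" if "u - r *\<^sub>R w \<in> disc" for r
  proof -
    have "u \<bullet> (u - r *\<^sub>R w) < 1" using inner_disc_less_1[OF _ u] that by simp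
    then have "0 < r" using uw by (simp add: inner_diff_right uu zero_less_mult_iff)
    then have "funk_ray u w k (- ln r / k) = u - r *\<^sub>R w" using k by (simp add: funk_ray_def)
    then show ?thesis by (metis rangeI)
  qed
  moreover have "affine hull {u, u - w} = range (\<lambda>r. u - r *\<^sub>R w)"
    by (simp add: affine_hull_2_alt)
  ultimately show ?thesis by (auto simp: funk_ray_def)
qed

text \<open>An end point of the chord serves as the target \<open>u\<close>. The speed
  \<open>k\<close> stays free because geodesics come with an arbitrary positive speed.\<close>

lemma chords_eq_rays:
  assumes k: "0 < k"
  shows "chords = {range (funk_ray u w k) \<inter> disc | u w.
    norm u = 1 \<and> range (funk_ray u w k) \<inter> disc \<noteq> {}}" (is "_ = ?R")
proof (intro equalityI subsetI)
  fix S assume "S \<in> chords"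
  then obtain l where l: "affine l" "aff_dim l = 1" "l \<inter> disc \<noteq> {}" and S: "S = l \<inter> disc"
    unfolding chords_def by blast
  then obtain x where x: "x \<in> l" "x \<in> disc" by blast
  have "l \<noteq> {x}" using l(2) by auto
  then obtain y where y: "y \<in> l" "y \<noteq> x" using x by blast
  obtain r where r: "0 < r" "norm (x + r *\<^sub>R (y - x)) = 1"
    using disc_ray_exit[OF x(2), of "y - x"] y(2) by auto
  define u where "u = x + r *\<^sub>R (y - x)"
  have "(1 - r) *\<^sub>R x + r *\<^sub>R y \<in> l" using l(1) x(1) y(1) by (simp add: affine_alt)
  then have u: "u \<in> l" "norm u = 1" "u \<noteq> x"
    using r y by (auto simp: u_def algebra_simps)
  have "affine hull {u, x} = l"
    by (rule affine_dim_equal) (use l u x in \<open>auto simp: hull_minimal aff_dim_affine_hull\<close>)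
  moreover have d: "funk_ray u (u - x) k 0 \<in> disc" using x(2) by (simp add: funk_ray_def)
  ultimately have "S = range (funk_ray u (u - x) k) \<inter> disc"
    using funk_ray_range_disc[OF u(2) k d] S by simp
  then show "S \<in> ?R" using d u(2) by blast
next
  fix S assume "S \<in> ?R"
  then obtain u w t where u: "norm u = 1" and S: "S = range (funk_ray u w k) \<inter> disc"
    and d: "funk_ray u w k t \<in> disc"
    by blast
  have "aff_dim (affine hull {u, u - w}) = 1"
    using funk_ray_nonzero[OF u d] by (simp add: aff_dim_affine_hull)
  moreover have "S = affine hull {u, u - w} \<inter> disc" using funk_ray_range_disc[OF u k d] S by simp
  moreover have "S \<noteq> {}" using S d by blast
  ultimately show "S \<in> chords" unfolding chords_def using affine_affine_hull by blast
qed

text \<open>The entry time \<open>T\<close> solves \<open>exp (- (k * T)) = q\<close>. The ray stays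
  in the disc at all later times, but it leaves the unit circle at a finite time.\<close>

lemma funk_ray_enters_disc:
  assumes u: "norm u = 1" and k: "0 < k" and d: "funk_ray u w k t0 \<in> disc"
  obtains T where "{t. funk_ray u w k t \<in> disc} = {T<..}" "norm (funk_ray u w k T) = 1"
proof -
  have w: "w \<noteq> 0" using funk_ray_nonzero[OF u d] .
  define q where "q = 2 * (u \<bullet> w) / (norm w)\<^sup>2"
  have n: "(norm w)\<^sup>2 > 0" using w by simp
  have iff: "funk_ray u w k t \<in> disc \<longleftrightarrow> exp (- (k * t)) < q"
      "norm (funk_ray u w k t) = 1 \<longleftrightarrow> exp (- (k * t)) = q" for t
    unfolding funk_ray_in_disc_iff[OF u w] q_def using n by (auto simp: field_simps)
  have "0 < exp (- (k * t0))" by simp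
  then have q: "0 < q" using d iff(1) by (meson less_trans)
  define T where "T = - ln q / k"
  have T: "exp (- (k * T)) = q" using k q by (simp add: T_def)
  have "exp (- (k * t)) < q \<longleftrightarrow> T < t" for t
    unfolding T[symmetric] using k by simp
  then have "{t. funk_ray u w k t \<in> disc} = {T<..}" using iff(1) by auto
  then show ?thesis using that iff(2) T by blast
qed

text \<open>A proper extension would be defined at the entry time \<open>T\<close>. Being a ray
  itself, it would agree with the given ray after \<open>T\<close> and, by continuity, at
  \<open>T\<close>, where the given ray is on the unit circle.\<close>

lemma maximal_ray:
  assumes u: "norm u = 1" and k: "0 < k" and d: "funk_ray u w k t0 \<in> disc"
  defines "I \<equiv> {t. funk_ray u w k t \<in> disc}"
  shows "maximal_geodesic poincare_metric disc I (\<lambda>t. funk_poincare (funk_ray u w k t))"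
    and "finsler_geodesic poincare_metric disc I (\<lambda>t. funk_poincare (funk_ray u w k t))"
proof -
  obtain T where I: "I = {T<..}" and T: "norm (funk_ray u w k T) = 1"
    using funk_ray_enters_disc[OF u k d] I_def by metis
  show geo: "finsler_geodesic poincare_metric disc I (\<lambda>t. funk_poincare (funk_ray u w k t))"
    by (rule ray_imp_finsler_geodesic[OF _ _ _ u k]) (auto simp: I is_interval_1, use I I_def in auto)
  have max: "J = I" if J: "finsler_geodesic poincare_metric disc J c" "I \<subseteq> J"
    and c: "\<forall>t\<in>I. c t = funk_poincare (funk_ray u w k t)" for J c
  proof (rule ccontr)
    assume "J \<noteq> I"
    then obtain s where s: "s \<in> J" "s \<le> T" using J(2) I by force
    have "is_interval J" using J(1) unfolding finsler_geodesic_def by blast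
    moreover have "T + 1 \<in> J" using J(2) I by auto
    ultimately have TJ: "T \<in> J" using mem_is_interval_1_I[of J s "T + 1" T] s by simp
    obtain u' w' k' where r: "\<And>t. t \<in> J \<Longrightarrow> funk_ray u' w' k' t \<in> disc
        \<and> c t = funk_poincare (funk_ray u' w' k' t)"
      using finsler_geodesic_imp_ray[OF J(1)] by metis
    have eq: "funk_ray u' w' k' t - funk_ray u w k t = 0" if "t \<in> {T<..}" for t
    proof -
      have "t \<in> I" "t \<in> J" using that I J(2) by auto
      then show ?thesis
        using r[of t] c poincare_funk_funk_poincare unfolding I_def by (metis mem_Collect_eq right_minus_eq)
    qed
    have "continuous_on (closure {T<..}) (\<lambda>t. funk_ray u' w' k' t - funk_ray u w k t)"
      by (intro continuous_on_diff continuous_on_funk_ray)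
    from continuous_constant_on_closure[OF this eq]
    have "funk_ray u' w' k' T - funk_ray u w k T = 0" by simp
    then show False using r[OF TJ] T by simp
  qed
  show "maximal_geodesic poincare_metric disc I (\<lambda>t. funk_poincare (funk_ray u w k t))"
    unfolding maximal_geodesic_def using geo max by blast
qed

lemma geodesic_trajectories_eq_chords:
  "geodesic_trajectories poincare_metric disc = (`) funk_poincare ` chords"
proof (intro equalityI subsetI)
  fix S assume "S \<in> geodesic_trajectories poincare_metric disc"
  then obtain I c where S: "S = c ` I" and max: "maximal_geodesic poincare_metric disc I c"
    unfolding geodesic_trajectories_def by blast
  have geo: "finsler_geodesic poincare_metric disc I c"
    using max unfolding maximal_geodesic_def by blast
  obtain u w k where u: "norm u = 1" and k: "0 < k"
    and r: "\<And>t. t \<in> I \<Longrightarrow> funk_ray u w k t \<in> disc \<and> c t = funk_poincare (funk_ray u w k t)"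
    using finsler_geodesic_imp_ray[OF geo] by metis
  obtain t0 where t0: "t0 \<in> I" using geo unfolding finsler_geodesic_def by blast
  define J where "J = {t. funk_ray u w k t \<in> disc}"
  have "finsler_geodesic poincare_metric disc J (\<lambda>t. funk_poincare (funk_ray u w k t))"
    using maximal_ray(2)[OF u k] r[OF t0] J_def by blast
  moreover have "I \<subseteq> J" using r J_def by blast
  \<comment> \<open>The ray on \<open>J\<close> extends \<open>c\<close>, so maximality of
    \<open>c\<close> excludes a larger interval.\<close>
  ultimately have "J = I" using max r unfolding maximal_geodesic_def by metis
  then have "S = (\<lambda>t. funk_poincare (funk_ray u w k t)) ` J"
    unfolding S using r by (intro image_cong) auto
  then have "S = funk_poincare ` (range (funk_ray u w k) \<inter> disc)"
    unfolding J_def by blast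
  moreover have "range (funk_ray u w k) \<inter> disc \<in> chords"
    unfolding chords_eq_rays[OF k] using u r[OF t0] by blast
  ultimately show "S \<in> (`) funk_poincare ` chords" by blast
next
  fix S assume "S \<in> (`) funk_poincare ` chords"
  then obtain u w t where u: "norm u = 1" and d: "funk_ray u w 1 t \<in> disc"
    and S: "S = funk_poincare ` (range (funk_ray u w 1) \<inter> disc)"
    unfolding chords_eq_rays[OF zero_less_one] by blast
  have "S = (\<lambda>t. funk_poincare (funk_ray u w 1 t)) ` {t. funk_ray u w 1 t \<in> disc}"
    unfolding S by blast
  then show "S \<in> geodesic_trajectories poincare_metric disc"
    unfolding geodesic_trajectories_def using maximal_ray(1)[OF u zero_less_one d] by blast
qed

text \<open>In the plane lines are hyperplanes, and the equational form is suited to computing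
  images under \<open>funk_poincare\<close>.\<close>

lemma chords_eq_hyperplanes:
  "chords = {{x. a \<bullet> x = b} \<inter> disc | a b. a \<noteq> 0 \<and> {x. a \<bullet> x = b} \<inter> disc \<noteq> {}}" (is "_ = ?R")
proof (intro equalityI subsetI)
  fix S assume "S \<in> chords"
  then obtain l where l: "affine l" "aff_dim l = 1" "l \<inter> disc \<noteq> {}" "S = l \<inter> disc"
    unfolding chords_def by blast
  then obtain a b where "a \<noteq> 0" "l = {x. a \<bullet> x = b}"
    using aff_dim_eq_hyperplane[of l] by (auto simp: affine_hull_eq[THEN iffD2])
  then show "S \<in> ?R" using l by blast
next
  fix S assume "S \<in> ?R"
  then obtain a b where "a \<noteq> 0" "{x. a \<bullet> x = b} \<inter> disc \<noteq> {}" "S = {x. a \<bullet> x = b} \<inter> disc"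
    by blast
  moreover have "aff_dim {x. a \<bullet> x = b} = 1" using \<open>a \<noteq> 0\<close> by simp
  ultimately show "S \<in> chords" unfolding chords_def using affine_hyperplane by blast
qed

subsection \<open>Images of chords\<close>

text \<open>Substitution of \<open>poincare_funk y\<close> for \<open>x\<close> in the equation of
  the line, with the positive denominator \<open>1 + |y|^2\<close> cleared.\<close>

lemma funk_poincare_image_hyperplane:
  "funk_poincare ` ({x. a \<bullet> x = b} \<inter> disc) = {y. 2 * (a \<bullet> y) = b * (1 + (norm y)\<^sup>2)} \<inter> disc"
proof -
  have "1 + (norm y)\<^sup>2 > 0" for y :: "real^2" by (simp add: add_pos_nonneg)
  then have iff: "a \<bullet> poincare_funk y = b \<longleftrightarrow> 2 * (a \<bullet> y) = b * (1 + (norm y)\<^sup>2)" for y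
    by (simp add: poincare_funk_def divide_eq_eq less_imp_neq[THEN not_sym])
  show ?thesis
  proof (intro equalityI subsetI)
    fix y assume "y \<in> funk_poincare ` ({x. a \<bullet> x = b} \<inter> disc)"
    then obtain x where "a \<bullet> x = b" "x \<in> disc" "y = funk_poincare x" by blast
    then show "y \<in> {y. 2 * (a \<bullet> y) = b * (1 + (norm y)\<^sup>2)} \<inter> disc"
      using iff[of y] poincare_funk_funk_poincare funk_poincare_in_disc by simp
  next
    fix y assume "y \<in> {y. 2 * (a \<bullet> y) = b * (1 + (norm y)\<^sup>2)} \<inter> disc"
    then have "y = funk_poincare (poincare_funk y)" "poincare_funk y \<in> {x. a \<bullet> x = b} \<inter> disc"
      using iff[of y] funk_poincare_poincare_funk poincare_funk_in_disc by simp_all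
    then show "y \<in> funk_poincare ` ({x. a \<bullet> x = b} \<inter> disc)" by blast
  qed
qed

section \<open>Diameters, by way of the quarter turn \<open>rot\<close>\<close>

definition rot :: "real^2 \<Rightarrow> real^2" where
  "rot x = vector [- x $ 2, x $ 1]"

lemma inner_real2: "(x::real^2) \<bullet> y = x $ 1 * y $ 1 + x $ 2 * y $ 2"
  by (simp add: inner_vec_def sum_2)

lemma rot_components [simp]: "rot x $ 1 = - x $ 2" "rot x $ 2 = x $ 1"
  by (simp_all add: rot_def)

lemma inner_rot [simp]: "rot x \<bullet> rot y = x \<bullet> y" "x \<bullet> rot x = 0" "rot x \<bullet> x = 0"
  by (simp_all add: inner_real2)

lemma norm_rot [simp]: "norm (rot x) = norm x"
  by (simp add: norm_eq_sqrt_inner)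

lemma rot_rot: "rot (rot x) = - x"
  by (simp add: vec_eq_iff forall_2)

lemma rot_scaleR: "rot (r *\<^sub>R x) = r *\<^sub>R rot x"
  by (simp add: vec_eq_iff forall_2)

lemma diameter_eq_hyperplane:
  assumes u: "norm u = 1"
  shows "open_segment (- u) u = {y. rot u \<bullet> y = 0} \<inter> disc"
proof (intro equalityI subsetI)
  fix y assume "y \<in> open_segment (- u) u"
  then obtain s where s: "0 < s" "s < 1" "y = (1 - s) *\<^sub>R (- u) + s *\<^sub>R u"
    by (auto simp: in_segment)
  have y: "y = (2 * s - 1) *\<^sub>R u" unfolding s(3) by (simp add: vec_eq_iff algebra_simps)
  have "norm y < 1" unfolding y using u s(1,2) by simp
  then show "y \<in> {y. rot u \<bullet> y = 0} \<inter> disc" by (simp add: y)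
next
  fix y assume y: "y \<in> {y. rot u \<bullet> y = 0} \<inter> disc"
  have uu: "u $ 1 * u $ 1 + u $ 2 * u $ 2 = 1"
    using u dot_square_norm[of u] by (simp add: inner_real2)
  have ry: "u $ 1 * y $ 2 = u $ 2 * y $ 1" using y by (simp add: inner_real2)
  \<comment> \<open>A vector orthogonal to \<open>rot u\<close> is parallel to the unit vector
    \<open>u\<close>, with coefficient \<open>u \<bullet> y\<close>.\<close>
  have "y $ 1 = (u \<bullet> y) * u $ 1" "y $ 2 = (u \<bullet> y) * u $ 2"
    unfolding inner_real2 using uu ry by algebra+
  then have yu: "y = (u \<bullet> y) *\<^sub>R u" by (simp add: vec_eq_iff forall_2)
  have "\<bar>u \<bullet> y\<bar> < 1" using y u Cauchy_Schwarz_ineq2[of u y] by simp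
  define s where "s = (1 + u \<bullet> y) / 2"
  have "0 < s" "s < 1" using \<open>\<bar>u \<bullet> y\<bar> < 1\<close> by (auto simp: s_def)
  moreover have "y = (1 - s) *\<^sub>R (- u) + s *\<^sub>R u"
  proof -
    have "(1 - s) *\<^sub>R (- u) + s *\<^sub>R u = (2 * s - 1) *\<^sub>R u" by (simp add: vec_eq_iff algebra_simps)
    also have "2 * s - 1 = u \<bullet> y" by (simp add: s_def field_simps)
    finally show ?thesis using yu by metis
  qed
  \<comment> \<open>\<open>open_segment\<close> is empty when its end points coincide, so membership
    requires them to differ.\<close>
  moreover have "- u \<noteq> u"
  proof
    assume "- u = u"
    then have "- u $ 1 = u $ 1" "- u $ 2 = u $ 2" by (metis vector_uminus_component)+
    then show False using uu by simp
  qed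
  ultimately show "y \<in> open_segment (- u) u" unfolding in_segment by blast
qed

lemma diametric_segments_eq:
  "diametric_segments = {{y. a \<bullet> y = 0} \<inter> disc | a. a \<noteq> 0}"
proof (intro equalityI subsetI)
  fix S assume "S \<in> diametric_segments"
  then obtain u where "norm u = 1" "S = open_segment (- u) u" unfolding diametric_segments_def by blast
  moreover have "rot u \<noteq> 0" using \<open>norm u = 1\<close> by (metis norm_rot norm_zero zero_neq_one)
  ultimately show "S \<in> {{y. a \<bullet> y = 0} \<inter> disc | a. a \<noteq> 0}"
    using diameter_eq_hyperplane by blast
next
  fix S assume "S \<in> {{y. a \<bullet> y = 0} \<inter> disc | a. a \<noteq> 0}"
  then obtain a where a: "a \<noteq> 0" "S = {y. a \<bullet> y = 0} \<inter> disc" by blast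
  \<comment> \<open>\<open>rot u\<close> must be parallel to the normal \<open>a\<close>; since
    \<open>rot (rot a) = - a\<close>, the normalised \<open>rot a\<close> works.\<close>
  define u where "u = (1 / norm a) *\<^sub>R rot a"
  have "norm u = 1" using a(1) by (simp add: u_def)
  moreover have "rot u \<bullet> y = 0 \<longleftrightarrow> a \<bullet> y = 0" for y
    using a(1) by (simp add: u_def rot_scaleR rot_rot)
  ultimately show "S \<in> diametric_segments"
    unfolding diametric_segments_def using diameter_eq_hyperplane a(2) by auto
qed

section \<open>Circles orthogonal to the unit circle\<close>

text \<open>When \<open>|z - y|^2 = r^2\<close> is expanded, the hypothesis on \<open>z\<close>
  cancels \<open>r^2\<close> and leaves the equation found for the image of the chord
  \<open><z, x> = 1\<close>.\<close>

lemma sphere_iff_inner: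
  fixes y z :: "'a::real_inner"
  assumes "0 < r" "(norm z)\<^sup>2 = 1 + r\<^sup>2"
  shows "y \<in> sphere z r \<longleftrightarrow> 2 * (z \<bullet> y) = 1 + (norm y)\<^sup>2"
proof -
  have "y \<in> sphere z r \<longleftrightarrow> (norm (z - y))\<^sup>2 = r\<^sup>2"
    using assms(1) by (simp add: dist_norm power2_eq_iff_nonneg)
  also have "(norm (z - y))\<^sup>2 = 1 + r\<^sup>2 - 2 * (z \<bullet> y) + (norm y)\<^sup>2"
    unfolding assms(2)[symmetric]
    by (simp add: power2_norm_eq_inner inner_diff_left inner_diff_right inner_commute[of y z])
  finally show ?thesis by auto
qed

text \<open>Pythagoras: both conditions express a right angle at \<open>p\<close> in the triangle
  with vertices 0, \<open>z\<close> and a common point \<open>p\<close> of the circles. The converse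
  also has to produce such a point.\<close>

lemma orthogonal_circles_unit_iff:
  assumes r: "0 < r"
  shows "orthogonal_circles z r 0 1 \<longleftrightarrow> (norm z)\<^sup>2 = 1 + r\<^sup>2"
proof
  assume "orthogonal_circles z r 0 1"
  then obtain p where "p \<in> sphere z r \<inter> sphere 0 1"
    and orth: "\<forall>v\<in>circle_tangent z p. \<forall>v'\<in>circle_tangent 0 p. orthogonal v v'"
    unfolding orthogonal_circles_def by blast
  then have p: "p \<in> sphere z r" "norm p = 1" by simp_all
  \<comment> \<open>Rotated radii are tangents, and \<open>rot\<close> preserves inner products, so
    orthogonality passes to the radii.\<close>
  have "rot (p - z) \<in> circle_tangent z p" "rot p \<in> circle_tangent 0 p"
    by (simp_all add: circle_tangent_def)
  then have "rot (p - z) \<bullet> rot p = 0" using orth unfolding orthogonal_def by blast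
  then have 0: "(p - z) \<bullet> p = 0" by simp
  have "(norm (p - z))\<^sup>2 = r\<^sup>2" using p(1) by (simp add: dist_norm norm_minus_commute)
  then have "p \<bullet> p + z \<bullet> z - 2 * (z \<bullet> p) = r\<^sup>2"
    by (simp add: power2_norm_eq_inner inner_diff_left inner_diff_right inner_commute[of p z])
  moreover have "p \<bullet> p = 1" using p(2) by (simp add: dot_square_norm)
  ultimately show "(norm z)\<^sup>2 = 1 + r\<^sup>2" using 0 by (simp add: power2_norm_eq_inner inner_diff_left)
next
  assume z: "(norm z)\<^sup>2 = 1 + r\<^sup>2"
  note sph = sphere_iff_inner[OF r z]
  have z0: "z \<bullet> z = 1 + r\<^sup>2" "1 + r\<^sup>2 \<noteq> 0"
    using z by (simp_all add: dot_square_norm) (smt (verit) zero_le_power2)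
  \<comment> \<open>One of the two points where the tangents from \<open>z\<close> touch the unit
    circle.\<close>
  define p where "p = (1 / (1 + r\<^sup>2)) *\<^sub>R (z + r *\<^sub>R rot z)"
  have zp: "z \<bullet> p = 1" using z0 by (simp add: p_def inner_add_right)
  have "(z + r *\<^sub>R rot z) \<bullet> (z + r *\<^sub>R rot z) = (1 + r\<^sup>2) * (1 + r\<^sup>2)"
    by (simp add: inner_add_left inner_add_right z0 algebra_simps power2_eq_square)
  then have "p \<bullet> p = 1" using z0 by (simp add: p_def)
  then have np: "norm p = 1" by (simp add: norm_eq_sqrt_inner)
  have "p \<in> sphere z r \<inter> sphere 0 1" using sph[of p] zp np by simp
  moreover have "orthogonal v v'"
    if p: "p \<in> sphere z r \<inter> sphere 0 1" and v: "v \<in> circle_tangent z p" "v' \<in> circle_tangent 0 p"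
    for p v v'
  proof -
    define q where "q = p - z"
    have pp: "p \<bullet> p = 1" using p by (simp add: dot_square_norm)
    have zp: "z \<bullet> p = 1" using p sph[of p] by simp
    have qp: "q \<bullet> p = 0" using pp zp by (simp add: q_def inner_diff_left)
    have "q \<bullet> q = r\<^sup>2" using pp zp z0 by (simp add: q_def inner_diff_left inner_diff_right inner_commute)
    then have qq: "q \<bullet> q \<noteq> 0" using r by simp
    have "q \<bullet> v = 0" "p \<bullet> v' = 0" using v by (simp_all add: circle_tangent_def q_def)
    \<comment> \<open>\<open>q\<close> and \<open>p\<close> are orthogonal and nonzero, so in the
      plane \<open>v\<close> is a multiple of \<open>p\<close> and \<open>v'\<close> a multiple of
      \<open>q\<close>; the extra factors keep the identity polynomial.\<close>
    then have "(q \<bullet> q) * (p \<bullet> p) * (v \<bullet> v') = 0" using qp unfolding inner_real2 by algebra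
    then show ?thesis using qq pp by (simp add: orthogonal_def)
  qed
  ultimately show "orthogonal_circles z r 0 1" unfolding orthogonal_circles_def by blast
qed

lemma orthogonal_arcs_eq:
  "orthogonal_arcs = {{y. 2 * (z \<bullet> y) = 1 + (norm y)\<^sup>2} \<inter> disc | z. 1 < norm z}" (is "_ = ?R")
proof (intro equalityI subsetI)
  fix S assume "S \<in> orthogonal_arcs"
  then obtain z r where r: "0 < r" "(norm z)\<^sup>2 = 1 + r\<^sup>2" and S: "S = sphere z r \<inter> disc"
    unfolding orthogonal_arcs_def using orthogonal_circles_unit_iff by blast
  have "1 < (norm z)\<^sup>2" using r by simp
  then have "1 < norm z" using power_less_imp_less_base[of 1 2 "norm z"] by simp
  moreover have "S = {y. 2 * (z \<bullet> y) = 1 + (norm y)\<^sup>2} \<inter> disc"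
    unfolding S using sphere_iff_inner[OF r] by blast
  ultimately show "S \<in> ?R" by blast
next
  fix S assume "S \<in> ?R"
  then obtain z where z: "1 < norm z" and S: "S = {y. 2 * (z \<bullet> y) = 1 + (norm y)\<^sup>2} \<inter> disc" by blast
  define r where "r = sqrt ((norm z)\<^sup>2 - 1)"
  have "1 < (norm z)\<^sup>2" using z by simp
  then have r: "0 < r" "(norm z)\<^sup>2 = 1 + r\<^sup>2" by (simp_all add: r_def)
  have "S = sphere z r \<inter> disc"
    unfolding S using sphere_iff_inner[OF r] by blast
  then show "S \<in> orthogonal_arcs"
    unfolding orthogonal_arcs_def using orthogonal_circles_unit_iff[OF r(1)] r by blast
qed

text \<open>The chord \<open>a \<bullet> x = b\<close> contains 0 exactly for \<open>b = 0\<close>,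
  and then the quadratic term in the equation of its image vanishes.\<close>

lemma central_chords_image:
  "(`) funk_poincare ` {S \<in> chords. 0 \<in> S} = diametric_segments"
proof -
  have "{S \<in> chords. 0 \<in> S} = {{x. a \<bullet> x = 0} \<inter> disc | a. a \<noteq> 0}" (is "?L = ?R")
  proof (intro equalityI subsetI)
    fix S assume "S \<in> ?L"
    then show "S \<in> ?R" unfolding chords_eq_hyperplanes by auto
  next
    fix S assume "S \<in> ?R"
    then obtain a where "a \<noteq> 0" "S = {x. a \<bullet> x = 0} \<inter> disc" by blast
    moreover have "0 \<in> {x. a \<bullet> x = 0} \<inter> disc" by simp
    ultimately show "S \<in> ?L" unfolding chords_eq_hyperplanes by blast
  qed
  moreover have "funk_poincare ` ({x. a \<bullet> x = 0} \<inter> disc) = {y. a \<bullet> y = 0} \<inter> disc" for a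
    unfolding funk_poincare_image_hyperplane by simp
  ultimately show ?thesis unfolding diametric_segments_eq by (simp add: setcompr_eq_image image_image)
qed

text \<open>A chord off the centre can be normalised to \<open>z \<bullet> x = 1\<close>. The line
  has distance \<open>1 / |z|\<close> from 0, so it meets the disc exactly for
  \<open>|z| > 1\<close>.\<close>

lemma noncentral_chords_image:
  "(`) funk_poincare ` {S \<in> chords. 0 \<notin> S} = orthogonal_arcs"
proof -
  have "{S \<in> chords. 0 \<notin> S} = {{x. z \<bullet> x = 1} \<inter> disc | z. 1 < norm z}" (is "?L = ?R")
  proof (intro equalityI subsetI)
    fix S assume "S \<in> ?L"
    then obtain a b x where S: "S = {x. a \<bullet> x = b} \<inter> disc" and x: "a \<bullet> x = b" "x \<in> disc" and "0 \<notin> S"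
      unfolding chords_eq_hyperplanes by blast
    then have "b \<noteq> 0" by auto
    define z where "z = (1 / b) *\<^sub>R a"
    have "S = {x. z \<bullet> x = 1} \<inter> disc" using \<open>b \<noteq> 0\<close> by (auto simp: S z_def)
    moreover have "1 < norm z"
    proof -
      have "z \<bullet> x = 1" using x(1) \<open>b \<noteq> 0\<close> by (simp add: z_def)
      then have "1 \<le> norm z * norm x" using norm_cauchy_schwarz[of z x] by simp
      moreover have "z \<noteq> 0" using \<open>z \<bullet> x = 1\<close> by auto
      then have "norm z * norm x < norm z * 1" using x(2) by (intro mult_strict_left_mono) auto
      ultimately show ?thesis by simp
    qed
    ultimately show "S \<in> ?R" by blast
  next
    fix S assume "S \<in> ?R"
    then obtain z where z: "1 < norm z" and S: "S = {x. z \<bullet> x = 1} \<inter> disc" by blast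
    have z0: "z \<noteq> 0" using z by auto
    \<comment> \<open>The foot of the perpendicular from 0 to the line witnesses that the chord is
      nonempty.\<close>
    have "norm ((1 / (norm z)\<^sup>2) *\<^sub>R z) = 1 / norm z" using z0 by (simp add: power2_eq_square)
    then have "(1 / (norm z)\<^sup>2) *\<^sub>R z \<in> {x. z \<bullet> x = 1} \<inter> disc"
      using z z0 by (simp add: dot_square_norm)
    moreover have "0 \<notin> S" by (simp add: S)
    ultimately show "S \<in> ?L" unfolding chords_eq_hyperplanes using z0 S by blast
  qed
  moreover have "funk_poincare ` ({x. z \<bullet> x = 1} \<inter> disc) = {y. 2 * (z \<bullet> y) = 1 + (norm y)\<^sup>2} \<inter> disc" for z
    unfolding funk_poincare_image_hyperplane by simp
  ultimately show ?thesis unfolding orthogonal_arcs_eq by (simp add: setcompr_eq_image image_image)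
qed

theorem theorem4p2:
  shows "geodesic_trajectories poincare_metric disc = diametric_segments \<union> orthogonal_arcs
    \<and> (`) funk_poincare ` {S \<in> chords. 0 \<in> S} = diametric_segments
    \<and> (`) funk_poincare ` {S \<in> chords. 0 \<notin> S} = orthogonal_arcs"
proof -
  have split: "{S \<in> chords. 0 \<in> S} \<union> {S \<in> chords. 0 \<notin> S} = chords" by blast
  have "geodesic_trajectories poincare_metric disc = diametric_segments \<union> orthogonal_arcs"
    unfolding geodesic_trajectories_eq_chords central_chords_image[symmetric]
      noncentral_chords_image[symmetric] image_Un[symmetric] split ..
  then show ?thesis by (intro conjI central_chords_image noncentral_chords_image)
qed

end
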